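(* Let $n\ge 1$ and let $S$ be a 2-free set of maximal order in $AG(n,2)\cong F_2^n$. Then $$c\cdot 2^{n/2}+1\le |S|<\sqrt{3}\cdot 2^{n/2},$$ where $c=1$ if $n\equiv 0 \pmod 2$ and $c=2^{-1/2}$ if $n\equiv 1\pmod 2$.
   Context: An affine subspace of $AG(n,2)\cong F_2^n$ is a set $a+L$ with $a\in F_2^n$ and $L$ a linear subspace; its dimension is $\dim L$. A set $S$ of points of $AG(n,2)$ is called 2-free if it contains no affine subspace of dimension 2; a 2-free set of maximal order is one of largest possible cardinality among all 2-free sets in $AG(n,2)$. *)

theory Defs
  imports "HOL-Analysis.Analysis" "HOL-Library.Z2"
begin

text \<open>
  The points of $AG(n,2)$ are the vectors of type \<open>bit ^ 'n\<close>, over the field \<open>bit\<close> of two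
  elements, with \<open>n = CARD('n)\<close>. Subspaces and dimension are those of the vector space
  \<open>bit ^ 'n\<close> over \<open>bit\<close>, i.e. \<open>vec.subspace\<close> and \<open>vec.dim\<close>; the unprefixed constants
  \<open>subspace\<close>, \<open>dim\<close>, \<open>affine\<close> and \<open>aff_dim\<close> refer to real scalars.
\<close>

definition affine_subspace_of_dim :: "nat \<Rightarrow> (bit ^ 'n) set \<Rightarrow> bool" where
  "affine_subspace_of_dim d A \<longleftrightarrow>
     (\<exists>a L. vec.subspace L \<and> vec.dim L = d \<and> A = (\<lambda>x. a + x) ` L)"

definition two_free :: "(bit ^ 'n) set \<Rightarrow> bool" where
  "two_free S \<longleftrightarrow> \<not> (\<exists>A. affine_subspace_of_dim 2 A \<and> A \<subseteq> S)"

definition two_free_of_maximal_order :: "(bit ^ 'n) set \<Rightarrow> bool" where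
  "two_free_of_maximal_order S \<longleftrightarrow>
     two_free S \<and> (\<forall>T :: (bit ^ 'n) set. two_free T \<longrightarrow> card T \<le> card S)"

end

theory Submission
  imports Defs "HOL-Algebra.Algebraic_Closure_Type"
begin

text \<open>
  In characteristic 2 a set is 2-free iff it is a Sidon set, i.e.\ iff the sums of its
  two-element subsets are distinct. Counting these nonzero sums gives
  $s(s-1)/2 \le 2^n - 1$, hence the upper bound. For the lower bound let $q = 2^m$ with
  $m = \lfloor n/2 \rfloor \ge 1$. The $q+1$ roots of $x^{q+1} = 1$ lie in the field of $q^2$
  elements, where $x \mapsto x^q$ is additive and inverts them; so $x + y$ determines
  $1/x + 1/y$, and thus $xy$ if $x \ne y$. They form a Sidon set, which is carried over to
  $F_2^n$ by an injective linear map.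
\<close>

text \<open>The alternative \<open>a = b\<close> is for characteristic 2, where \<open>a + a = c + c\<close> always holds.\<close>

definition sidon :: "'a::ab_semigroup_add set \<Rightarrow> bool" where
  "sidon S \<longleftrightarrow> (\<forall>a\<in>S. \<forall>b\<in>S. \<forall>c\<in>S. \<forall>d\<in>S. a + b = c + d \<longrightarrow> a = b \<or> a = c \<or> a = d)"

section \<open>2-free sets and Sidon sets\<close>

lemma UNIV_bit: "(UNIV :: bit set) = {0, 1}"
  by (auto intro: bit.exhaust)

lemma card_UNIV_bit_vec: "card (UNIV :: (bit ^ 'n) set) = 2 ^ CARD('n)"
  by (simp add: UNIV_bit numeral_2_eq_2)

lemma finite_bit_vec [simp]: "finite (A :: (bit ^ 'n) set)"
proof -
  have "finite (UNIV :: (bit ^ 'n) set)"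
    by (rule card_ge_0_finite) (simp add: card_UNIV_bit_vec del: CARD_vec)
  then show ?thesis
    by (rule finite_subset[rotated]) simp
qed

lemma bit_vec_add_self [simp]: "x + x = (0 :: bit ^ 'n)"
proof -
  have "b + b = 0" for b :: bit
    by (cases b) simp_all
  then show ?thesis
    by (simp add: vec_eq_iff del: add_bit_eq_xor)
qed

lemma bit_vec_minus [simp]: "- x = (x :: bit ^ 'n)"
  using bit_vec_add_self[of x] by (metis minus_unique)

lemma bit_vec_diff: "x - y = x + (y :: bit ^ 'n)"
  using bit_vec_minus[of y] by (metis add_uminus_conv_diff)

lemma bit_vec_add_eq_0_iff: "x + y = 0 \<longleftrightarrow> x = (y :: bit ^ 'n)"
  by (metis bit_vec_diff right_minus_eq)

lemma bit_span_singleton: "vec.span {u :: bit ^ 'n} = {0, u}"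
proof -
  have "range (\<lambda>k :: bit. k *s u) = {0, u}"
    by (simp add: UNIV_bit)
  then show ?thesis
    by (simp add: vec.span_singleton)
qed

lemma bit_span_pair: "vec.span {u, v :: bit ^ 'n} = {0, u, v, u + v}"
proof -
  have "x \<in> vec.span {u, v} \<longleftrightarrow> x \<in> {0, u, v, u + v}" for x
  proof -
    have "x \<in> vec.span {u, v} \<longleftrightarrow> (\<exists>k :: bit. x - k *s u \<in> {0, v})"
      by (simp add: vec.span_breakdown_eq bit_span_singleton)
    also have "\<dots> \<longleftrightarrow> x \<in> {0, v} \<or> x - u \<in> {0, v}"
    proof -
      have "(\<exists>k :: bit. P k) \<longleftrightarrow> P 0 \<or> P 1" for P
        by (metis bit.exhaust)
      then show ?thesis by simp
    qed
    also have "\<dots> \<longleftrightarrow> x \<in> {0, u, v, u + v}"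
      by (auto simp: algebra_simps)
    finally show ?thesis .
  qed
  then show ?thesis by blast
qed

lemma bit_independent_pair_iff:
  fixes u v :: "bit ^ 'n"
  assumes "u \<noteq> v"
  shows "vec.independent {u, v} \<longleftrightarrow> u \<noteq> 0 \<and> v \<noteq> 0"
  using assms
  by (auto simp: vec.independent_insert bit_span_singleton)

text \<open>With scalars 0 and 1 only, a basis of the direction space has just four linear
  combinations. Conversely, two distinct nonzero vectors are independent over this field.\<close>

lemma affine_plane_iff:
  "affine_subspace_of_dim 2 (A :: (bit ^ 'n) set) \<longleftrightarrow>
     (\<exists>a u v. u \<noteq> 0 \<and> v \<noteq> 0 \<and> u \<noteq> v \<and> A = {a, a + u, a + v, a + (u + v)})"
    (is "_ \<longleftrightarrow> ?R")
proof
  assume "affine_subspace_of_dim 2 A"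
  then obtain a L where L: "vec.subspace L" "vec.dim L = 2" "A = (\<lambda>x. a + x) ` L"
    unfolding affine_subspace_of_dim_def by blast
  obtain B where B: "B \<subseteq> L" "vec.independent B" "L \<subseteq> vec.span B" "card B = 2"
    using vec.basis_exists[of L] L(2) by metis
  then obtain u v where uv: "B = {u, v}" "u \<noteq> v"
    by (meson card_2_iff)
  have "L = {0, u, v, u + v}"
    using vec.span_subspace[OF B(1) B(3) L(1)] uv bit_span_pair by metis
  then have "A = {a, a + u, a + v, a + (u + v)}"
    using L(3) by simp
  then show ?R
    using B(2) uv bit_independent_pair_iff by blast
next
  assume ?R
  then obtain a u v where uv: "u \<noteq> 0" "v \<noteq> 0" "u \<noteq> v" "A = {a, a + u, a + v, a + (u + v)}"
    by blast
  have "vec.dim (vec.span {u, v}) = 2"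
    using uv vec.dim_span_eq_card_independent[of "{u, v}"] by (simp add: bit_independent_pair_iff)
  moreover have "A = (\<lambda>x. a + x) ` vec.span {u, v}"
    using uv(4) by (simp add: bit_span_pair)
  ultimately show "affine_subspace_of_dim 2 A"
    unfolding affine_subspace_of_dim_def using vec.subspace_span by blast
qed

text \<open>In characteristic 2 the points of a plane sum to zero, so they split into two pairs with
  equal sums; conversely, four distinct points with \<open>a + b = c + d\<close> form a
  plane.\<close>

lemma two_free_iff_sidon: "two_free (S :: (bit ^ 'n) set) \<longleftrightarrow> sidon S"
proof
  assume free: "two_free S"
  show "sidon S"
    unfolding sidon_def
  proof (intro ballI impI)
    fix a b c d
    assume S: "a \<in> S" "b \<in> S" "c \<in> S" "d \<in> S" and eq: "a + b = c + d"
    show "a = b \<or> a = c \<or> a = d"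
    proof (rule ccontr)
      assume *: "\<not> (a = b \<or> a = c \<or> a = d)"
      have cancel: "a + (a + x) = x" for x
        by (simp flip: add.assoc)
      have "b \<noteq> c"
        using * eq by (auto simp: add.commute)
      \<comment> \<open>The plane starts at \<open>a\<close> and has directions \<open>a + b\<close>
        and \<open>a + c\<close>, which are differences in characteristic 2. Its fourth corner is
        \<open>d\<close>.\<close>
      moreover have "a + (a + b + (a + c)) = d"
        using eq by (metis add.assoc add.commute cancel bit_vec_add_self add_0)
      ultimately have "affine_subspace_of_dim 2 {a, b, c, d}"
        using * unfolding affine_plane_iff
        by (intro exI[of _ a] exI[of _ "a + b"] exI[of _ "a + c"])
          (auto simp: cancel bit_vec_add_eq_0_iff)
      then show False
        using free S unfolding two_free_def by blast
    qed
  qed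
next
  assume sid: "sidon S"
  show "two_free S"
    unfolding two_free_def
  proof
    assume "\<exists>A. affine_subspace_of_dim 2 A \<and> A \<subseteq> S"
    then obtain a u v where uv: "u \<noteq> 0" "v \<noteq> 0" "u \<noteq> v"
      and S: "{a, a + u, a + v, a + (u + v)} \<subseteq> S"
      unfolding affine_plane_iff by blast
    have "a + (a + (u + v)) = (a + u) + (a + v)"
      by (simp add: algebra_simps)
    then have "a = a + (u + v) \<or> a = a + u \<or> a = a + v"
      using sid S unfolding sidon_def by blast
    then show False
      using uv by (auto simp: bit_vec_add_eq_0_iff)
  qed
qed

section \<open>Counting the sums of pairs\<close>

lemma sidon_bit_vec_card:
  fixes S :: "(bit ^ 'n) set"
  assumes "sidon S"
  shows "card S * (card S - 1) \<le> 2 * (2 ^ CARD('n) - 1)"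
proof -
  let ?P = "{B. B \<subseteq> S \<and> card B = 2}"
  have pair: "\<exists>a b. B = {a, b} \<and> a \<noteq> b \<and> a \<in> S \<and> b \<in> S" if "B \<in> ?P" for B
    using that by (auto simp: card_2_iff)
  have inj: "inj_on \<Sum> ?P"
  proof
    fix B C assume "B \<in> ?P" "C \<in> ?P" and eq: "\<Sum>B = \<Sum>C"
    then obtain a b c d where
      *: "B = {a, b}" "a \<noteq> b" "a \<in> S" "b \<in> S" "C = {c, d}" "c \<noteq> d" "c \<in> S" "d \<in> S"
      using pair by meson
    then have sum: "a + b = c + d"
      using eq by simp
    then have "a = c \<or> a = d"
      using assms * unfolding sidon_def by blast
    then show "B = C"
    proof
      assume "a = c"
      with sum * show ?thesis by simp
    next
      assume "a = d"
      with sum have "b = c"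
        by (simp add: add.commute[of c])
      with \<open>a = d\<close> * show ?thesis by (simp add: insert_commute)
    qed
  qed
  \<comment> \<open>Distinct vectors never sum to 0. Excluding this one value is what makes the
    final upper bound strict.\<close>
  have "\<Sum> ` ?P \<subseteq> UNIV - {0}"
  proof
    fix y assume "y \<in> \<Sum> ` ?P"
    then obtain B where "B \<in> ?P" "y = \<Sum>B"
      by blast
    with pair[of B] obtain a b where "a \<noteq> b" "y = a + b"
      by auto
    then show "y \<in> UNIV - {0}"
      by (simp add: bit_vec_add_eq_0_iff)
  qed
  then have "card ?P \<le> card (UNIV - {0 :: bit ^ 'n})"
    by (rule card_inj_on_le[OF inj]) simp
  then have "card S choose 2 \<le> 2 ^ CARD('n) - 1"
    by (simp add: n_subsets card_Diff_singleton card_UNIV_bit_vec del: CARD_vec)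
  moreover have "2 * (card S choose 2) = card S * (card S - 1)"
    by (cases "card S") (simp_all add: choose_two)
  ultimately show ?thesis
    by linarith
qed

text \<open>Injectivity is asked on \<open>K\<close> because the equation pulled back along
  \<open>f\<close> is one between sums, which lie in \<open>K\<close> but need not lie in
  \<open>S\<close>.\<close>

lemma sidon_image:
  fixes f :: "'a::ab_semigroup_add \<Rightarrow> 'b::ab_semigroup_add"
  assumes "sidon S" "S \<subseteq> K" "inj_on f K"
    and closed: "\<And>x y. x \<in> K \<Longrightarrow> y \<in> K \<Longrightarrow> x + y \<in> K"
    and add: "\<And>x y. x \<in> K \<Longrightarrow> y \<in> K \<Longrightarrow> f (x + y) = f x + f y"
  shows "sidon (f ` S)"
  unfolding sidon_def
proof (intro ballI impI; elim imageE)
  fix x y z w a b c d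
  assume S: "a \<in> S" "b \<in> S" "c \<in> S" "d \<in> S"
    and im: "x = f a" "y = f b" "z = f c" "w = f d" and eq: "x + y = z + w"
  from S have K: "a \<in> K" "b \<in> K" "c \<in> K" "d \<in> K"
    using assms(2) by auto
  then have "f (a + b) = f (c + d)"
    using eq add im by simp
  then have "a + b = c + d"
    using assms(3) K closed by (simp add: inj_on_eq_iff)
  then have "a = b \<or> a = c \<or> a = d"
    using S assms(1) unfolding sidon_def by blast
  then show "x = y \<or> x = z \<or> x = w"
    using im by auto
qed

section \<open>Roots of unity in characteristic 2\<close>

text \<open>The polynomial splits into as many linear factors as its degree. A repeated factor would
  make its root a root of the derivative too, so the factors are distinct.\<close>

lemma alg_closed_card_roots_separable:
  fixes p :: "'a::alg_closed_field poly"
  assumes "p \<noteq> 0" and sep: "\<And>x. poly p x = 0 \<Longrightarrow> poly (pderiv p) x \<noteq> 0"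
  shows "card {x. poly p x = 0} = Polynomial.degree p"
proof -
  obtain A where A: "size A = Polynomial.degree p" "p = Polynomial.smult (Polynomial.lead_coeff p) (\<Prod>x\<in>#A. [:-x, 1:])"
    using alg_closed_imp_factorization[OF assms(1)] by blast
  have le1: "count A x \<le> 1" for x
  proof (rule ccontr)
    assume "\<not> count A x \<le> 1"
    then have "{#x, x#} \<subseteq># A"
      by (auto simp: subseteq_mset_def)
    then obtain B where "A = {#x, x#} + B"
      using mset_subset_eq_exists_conv by blast
    then have "p = [:-x, 1:] * ([:-x, 1:] * Polynomial.smult (Polynomial.lead_coeff p) (\<Prod>x\<in>#B. [:-x, 1:]))"
      using A(2) by (simp add: mult_smult_right)
    then obtain q where q: "p = [:-x, 1:] * ([:-x, 1:] * q)"
      by blast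
    have "poly p x = 0" "poly (pderiv p) x = 0"
      unfolding q by (simp_all add: pderiv_mult pderiv_pCons del: mult_pCons_left)
    with sep show False by blast
  qed
  have "A = mset_set (set_mset A)"
  proof (rule multiset_eqI)
    fix x
    have "x \<in># A \<Longrightarrow> count A x = 1"
      using le1[of x] by (simp add: le_antisym Suc_le_eq)
    then show "count A x = count (mset_set (set_mset A)) x"
      by (simp add: count_mset_set' not_in_iff)
  qed
  then have "card (set_mset A) = Polynomial.degree p"
    using A(1) by (metis size_mset_set)
  moreover have "poly p x = 0 \<longleftrightarrow> x \<in># A" for x
  proof -
    have "poly p x = Polynomial.lead_coeff p * (\<Prod>y\<in>#A. x - y)"
      by (subst A(2)) (simp add: poly_prod_mset)
    then show ?thesis
      using assms(1) by (auto simp: prod_mset_zero_iff)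
  qed
  ultimately show ?thesis by simp
qed

text \<open>The derivative \<open>k * x ^ (k - 1)\<close> of \<open>x ^ k - 1\<close> vanishes at
  most at 0, since \<open>k\<close> is nonzero in the field, and 0 is not a root.\<close>

lemma card_roots_of_unity:
  assumes "of_nat k \<noteq> (0 :: 'a::alg_closed_field)"
  shows "card {x :: 'a. x ^ k = 1} = k"
proof -
  let ?p = "Polynomial.monom 1 k - 1 :: 'a poly"
  have k: "k > 0"
    using assms by (cases k) auto
  have deg: "Polynomial.degree ?p = k"
    using k degree_add_eq_left[of "- 1" "Polynomial.monom (1 :: 'a) k"] by (simp add: degree_monom_eq)
  have "poly (pderiv ?p) x \<noteq> 0" if "poly ?p x = 0" for x
  proof -
    have "x \<noteq> 0"
      using that k by (auto simp: poly_monom power_0_left)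
    then show ?thesis
      using assms by (simp add: pderiv_diff pderiv_monom poly_monom)
  qed
  then have "card {x. poly ?p x = 0} = k"
    using alg_closed_card_roots_separable[of ?p] deg k by fastforce
  then show ?thesis
    by (simp add: poly_monom)
qed

text \<open>For \<open>k = 2 ^ (2 * m)\<close> in characteristic 2 the fixed points form the field
  that contains the roots of unity in question; the bound on its size limits its dimension over
  \<open>bit\<close>.\<close>

lemma card_frobenius_fixed:
  assumes "k \<ge> 2"
  shows "finite {x :: 'a::field. x ^ k = x}" "card {x :: 'a::field. x ^ k = x} \<le> k"
proof -
  let ?p = "Polynomial.monom 1 k - Polynomial.monom 1 1 :: 'a poly"
  have deg: "Polynomial.degree ?p = k"
    using assms degree_add_eq_left[of "- Polynomial.monom 1 1" "Polynomial.monom (1 :: 'a) k"]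
    by (simp add: degree_monom_eq)
  have ne: "?p \<noteq> 0"
    using deg assms by auto
  have "{x. poly ?p x = 0} = {x. x ^ k = x}"
    by (simp add: poly_monom)
  then show "finite {x :: 'a. x ^ k = x}" "card {x :: 'a. x ^ k = x} \<le> k"
    using poly_roots_finite[OF ne] card_poly_roots_bound[OF ne] deg by auto
qed

lemma sidon_roots_of_unity:
  fixes U :: "'a::field set" and m :: nat
  assumes "CHAR('a) = 2"
  defines "U \<equiv> {x. x ^ (2 ^ m + 1) = 1}"
  shows "sidon U"
  unfolding sidon_def
proof (intro ballI impI)
  fix a b c d
  assume U: "a \<in> U" "b \<in> U" "c \<in> U" "d \<in> U" and eq: "a + b = c + d"
  have frob: "(x + y) ^ 2 ^ m = x ^ 2 ^ m + y ^ 2 ^ m" for x y :: 'a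
    using freshmans_dream'[of "2 ^ m" m x y] assms(1) by simp
  have nz: "x \<noteq> 0" and inv: "x ^ 2 ^ m = 1 / x" if "x \<in> U" for x
    using that by (auto simp: U_def eq_divide_eq mult.commute)
  \<comment> \<open>Raising the equation to the power \<open>2 ^ m\<close> is additive and inverts
    each element of \<open>U\<close>.\<close>
  have "1 / a + 1 / b = 1 / c + 1 / d"
    using arg_cong[OF eq, of "\<lambda>x. x ^ 2 ^ m"] U by (simp add: frob inv)
  then have "(a + b) * (c * d) = (c + d) * (a * b)"
    using U nz by (simp add: field_simps)
  then have "a + b = 0 \<or> c * d = a * b"
    using eq by simp
  then show "a = b \<or> a = c \<or> a = d"
  proof
    assume "a + b = 0"
    moreover have "b + b = 0"
      using of_nat_CHAR[where 'a = 'a] assms(1) by (simp flip: mult_2)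
    ultimately have "a = b"
      by (metis add_right_cancel)
    then show ?thesis ..
  next
    assume *: "c * d = a * b"
    \<comment> \<open>The pairs now agree in sum and product, so \<open>a\<close> is a root of the
      quadratic with roots \<open>c\<close> and \<open>d\<close>.\<close>
    have "(a - c) * (a - d) = a * a - a * (c + d) + c * d"
      by (simp add: algebra_simps)
    also have "\<dots> = 0"
      unfolding * eq[symmetric] by (simp add: algebra_simps)
    finally show ?thesis by auto
  qed
qed

section \<open>Linear embedding into the bit vectors\<close>

text \<open>The algebraic closure as a vector space over its prime field, which supplies bases and
  coordinates.\<close>

interpretation ac_bit: vector_space "\<lambda>(b :: bit) (x :: bit alg_closure). to_ac b * x"
  by standard (simp_all add: algebra_simps del: add_bit_eq_xor mult_bit_eq_and)

text \<open>Take a basis \<open>B\<close> of \<open>K\<close> over \<open>bit\<close>. Its subset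
  sums are distinct and lie in \<open>K\<close>, so \<open>2 ^ card B\<close> is at most
  \<open>2 ^ CARD('n)\<close>. Hence the coordinates with respect to \<open>B\<close> fit into the
  \<open>CARD('n)\<close> positions of a vector.\<close>

lemma additive_embedding_bit_vec:
  fixes K :: "bit alg_closure set"
  assumes "finite K" and card: "card K \<le> 2 ^ CARD('n)"
    and "0 \<in> K" and closed: "\<And>x y. x \<in> K \<Longrightarrow> y \<in> K \<Longrightarrow> x + y \<in> K"
  obtains f :: "bit alg_closure \<Rightarrow> bit ^ 'n"
  where "inj_on f K" "\<And>x y. x \<in> K \<Longrightarrow> y \<in> K \<Longrightarrow> f (x + y) = f x + f y"
proof -
  obtain B where B: "B \<subseteq> K" "ac_bit.independent B" "K \<subseteq> ac_bit.span B"
    using ac_bit.maximal_independent_subset by metis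
  have fin: "finite B"
    using B(1) assms(1) finite_subset by blast
  \<comment> \<open>The coordinates of a subset sum are the indicator function of the subset, so the
    sum determines the subset.\<close>
  have ind: "ac_bit.representation B (\<Sum>x\<in>T. x) = (\<lambda>b. of_bool (b \<in> T))" if "T \<subseteq> B" for T
  proof (rule ac_bit.representation_eqI[OF B(2)])
    show "(\<Sum>x\<in>T. x) \<in> ac_bit.span B"
      using that by (intro ac_bit.span_sum ac_bit.span_base) auto
    have "{b. of_bool (b \<in> T) \<noteq> (0 :: bit)} = T"
      by (auto simp: of_bool_def split: if_splits)
    then show "finite {b. of_bool (b \<in> T) \<noteq> (0 :: bit)}"
      "(\<Sum>b | of_bool (b \<in> T) \<noteq> (0 :: bit). to_ac (of_bool (b \<in> T)) * b) = (\<Sum>x\<in>T. x)"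
      using that fin finite_subset by auto
  qed (use that in \<open>auto simp: of_bool_def split: if_splits\<close>)
  have "inj_on (\<lambda>T. \<Sum>x\<in>T. x) (Pow B)"
  proof
    fix T U assume "T \<in> Pow B" "U \<in> Pow B" "(\<Sum>x\<in>T. x) = (\<Sum>x\<in>U. x)"
    then have "(\<lambda>b. of_bool (b \<in> T) :: bit) = (\<lambda>b. of_bool (b \<in> U))"
      using ind by (metis PowD)
    then show "T = U"
      by (auto simp: fun_eq_iff of_bool_eq_iff)
  qed
  moreover have "(\<Sum>x\<in>T. x) \<in> K" if "T \<subseteq> B" for T
  proof -
    have "finite T"
      using that fin finite_subset by blast
    then show ?thesis
      using that by induction (use assms(3) closed B(1) in auto)
  qed
  ultimately have "card (Pow B) \<le> card K"
    using assms(1) by (intro card_inj_on_le) auto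
  then have "(2 :: nat) ^ card B \<le> 2 ^ CARD('n)"
    using card card_Pow[OF fin] by linarith
  then have "card B \<le> CARD('n)"
    by (rule power_le_imp_le_exp[rotated]) simp
  then obtain e :: "bit alg_closure \<Rightarrow> 'n" where e: "inj_on e B"
    using card_le_inj[OF fin, of "UNIV :: 'n set"] by auto
  \<comment> \<open>The coefficient of \<open>b\<close> is stored at position \<open>e b\<close>;
    positions outside the image of \<open>B\<close> hold 0.\<close>
  let ?f = "\<lambda>x. \<chi> i. if i \<in> e ` B then ac_bit.representation B x (inv_into B e i) else 0"
  show ?thesis
  proof
    show "inj_on ?f K"
    proof
      fix x y assume K: "x \<in> K" "y \<in> K" and eq: "?f x = ?f y"
      have "ac_bit.representation B x b = ac_bit.representation B y b" if "b \<in> B" for b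
        using arg_cong[OF eq, of "\<lambda>v. v $ e b"] that e by simp
      then have "(\<Sum>b\<in>B. to_ac (ac_bit.representation B x b) * b) =
          (\<Sum>b\<in>B. to_ac (ac_bit.representation B y b) * b)"
        by simp
      moreover have "x \<in> ac_bit.span B" "y \<in> ac_bit.span B"
        using K B(3) by auto
      ultimately show "x = y"
        by (simp only: ac_bit.sum_representation_eq[OF B(2) _ fin order_refl])
    qed
    show "?f (x + y) = ?f x + ?f y" if "x \<in> K" "y \<in> K" for x y
    proof -
      have "x \<in> ac_bit.span B" "y \<in> ac_bit.span B"
        using that B(3) by auto
      then show ?thesis
        by (simp add: vec_eq_iff ac_bit.representation_add[OF B(2)] del: add_bit_eq_xor)
    qed
  qed
qed

section \<open>The roots of unity as a Sidon set of bit vectors\<close>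

lemma CHAR_bit: "CHAR(bit) = 2"
  by (rule CHAR_eq_posI) (auto simp: less_2_cases_iff)

lemma ex_sidon_bit_vec:
  assumes "m \<ge> 1" "2 * m \<le> CARD('n)"
  shows "\<exists>S :: (bit ^ 'n) set. sidon S \<and> card S = 2 ^ m + 1"
proof -
  have char: "CHAR(bit alg_closure) = 2"
    by (simp add: CHAR_bit)
  define U where "U = {x :: bit alg_closure. x ^ (2 ^ m + 1) = 1}"
  define K where "K = {x :: bit alg_closure. x ^ 2 ^ (2 * m) = x}"
  \<comment> \<open>Here \<open>m \<ge> 1\<close> matters: an odd exponent is nonzero in
    characteristic 2, so there are as many roots of unity as the exponent says.\<close>
  have "odd (2 ^ m + 1 :: nat)"
    using assms(1) by simp
  then have "of_nat (2 ^ m + 1) \<noteq> (0 :: bit alg_closure)"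
    by (subst of_nat_eq_0_iff_char_dvd) (simp only: char not_False_eq_True)
  then have cardU: "card U = 2 ^ m + 1"
    unfolding U_def by (rule card_roots_of_unity)
  have "(2 :: nat) ^ 1 \<le> 2 ^ (2 * m)"
    using assms(1) by (intro power_increasing) auto
  then have K: "finite K" "card K \<le> 2 ^ (2 * m)"
    unfolding K_def using card_frobenius_fixed[of "2 ^ (2 * m)", where 'a = "bit alg_closure"]
    by simp_all
  have closed: "x + y \<in> K" if "x \<in> K" "y \<in> K" for x y
    using that freshmans_dream'[of "2 ^ (2 * m)" "2 * m" x y] char by (simp add: K_def)
  have sub: "U \<subseteq> K"
  proof
    fix x assume "x \<in> U"
    then have x: "x ^ 2 ^ m = 1 / x" "x \<noteq> 0"
      by (auto simp: U_def eq_divide_eq mult.commute)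
    \<comment> \<open>Two applications of the power \<open>2 ^ m\<close> invert \<open>x\<close>
      twice.\<close>
    have "x ^ 2 ^ (2 * m) = (x ^ 2 ^ m) ^ 2 ^ m"
      by (simp add: mult_2 power_add power_mult)
    also have "\<dots> = x"
      using x by (simp add: power_one_over)
    finally show "x \<in> K"
      by (simp add: K_def)
  qed
  have "(2 :: nat) ^ (2 * m) \<le> 2 ^ CARD('n)"
    using assms(2) by (intro power_increasing) auto
  with K have "card K \<le> 2 ^ CARD('n)"
    by linarith
  moreover have "0 \<in> K"
    by (simp add: K_def)
  ultimately obtain f :: "bit alg_closure \<Rightarrow> bit ^ 'n" where f: "inj_on f K"
    "\<And>x y. x \<in> K \<Longrightarrow> y \<in> K \<Longrightarrow> f (x + y) = f x + f y"
    using additive_embedding_bit_vec K(1) closed by metis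
  have "sidon (f ` U)"
    using sidon_image[OF sidon_roots_of_unity[OF char, of m] _ f(1) closed f(2)] sub
    by (simp add: U_def)
  moreover have "card (f ` U) = 2 ^ m + 1"
    using cardU f(1) sub by (simp add: card_image inj_on_subset)
  ultimately show ?thesis by blast
qed

section \<open>The bounds\<close>

theorem theorem3:
  fixes S :: "(bit ^ 'n) set" and c :: real
  assumes "two_free_of_maximal_order S"
    and "c = (if even CARD('n) then 1 else 2 powr (- 1 / 2))"
  shows "c * 2 powr (real CARD('n) / 2) + 1 \<le> real (card S) \<and>
         real (card S) < sqrt 3 * 2 powr (real CARD('n) / 2)"
proof
  let ?n = "CARD('n)" and ?m = "CARD('n) div 2" and ?s = "card S"
  have sid: "sidon S" and max: "\<And>T :: (bit ^ 'n) set. sidon T \<Longrightarrow> card T \<le> ?s"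
    using assms(1) by (auto simp: two_free_of_maximal_order_def two_free_iff_sidon)
  have "\<exists>T :: (bit ^ 'n) set. sidon T \<and> card T = 2 ^ ?m + 1"
  proof (cases "?m = 0")
    \<comment> \<open>This is dimension 1, where \<open>x ^ 2 = 1\<close> has the single root 1 in
      characteristic 2; any two points serve instead.\<close>
    case True
    have "sidon {0, 1 :: bit ^ 'n}"
      by (auto simp: sidon_def)
    moreover have "card {0, 1 :: bit ^ 'n} = 2"
      by simp
    ultimately show ?thesis
      unfolding True by (metis one_add_one power_0)
  next
    case False
    then show ?thesis
      by (intro ex_sidon_bit_vec) auto
  qed
  then have lower: "2 ^ ?m + 1 \<le> ?s"
    using max by metis
  \<comment> \<open>The constant \<open>c\<close> rounds the exponent \<open>n / 2\<close> down to
    an integer: for odd \<open>n\<close> it removes the extra half.\<close>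
  have "c * 2 powr (real ?n / 2) = 2 powr real ?m"
  proof (cases "even ?n")
    case True
    then show ?thesis
      using assms(2) by (simp add: real_of_nat_div)
  next
    case False
    then have "real ?n = 2 * real ?m + 1"
      by (metis odd_two_times_div_two_succ of_nat_1 of_nat_add of_nat_mult of_nat_numeral)
    then have "- 1 / 2 + real ?n / 2 = real ?m"
      by simp
    then show ?thesis
      using assms(2) False by (simp flip: powr_add)
  qed
  also have "\<dots> + 1 = real (2 ^ ?m + 1)"
    by (simp add: powr_realpow)
  finally show "c * 2 powr (real ?n / 2) + 1 \<le> real ?s"
    using lower by (simp only: of_nat_le_iff)
  \<comment> \<open>This trivial bound absorbs the linear term of the pair count:
    \<open>s * s \<le> 2 * (2 ^ n - 1) + s \<le> 3 * 2 ^ n - 2\<close>.\<close>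
  have "?s \<le> 2 ^ ?n"
    using card_mono[of UNIV S] by (simp add: card_UNIV_bit_vec del: CARD_vec)
  moreover have "?s * ?s \<le> 2 * (2 ^ ?n - 1) + ?s"
    using sidon_bit_vec_card[OF sid] by (cases ?s) auto
  moreover have "(1 :: nat) \<le> 2 ^ ?n"
    by simp
  ultimately have "?s * ?s < 3 * 2 ^ ?n"
    by linarith
  then have "real (?s * ?s) < real (3 * 2 ^ ?n)"
    by (simp only: of_nat_less_iff)
  then have "(real ?s)\<^sup>2 < 3 * 2 ^ ?n"
    by (simp add: power2_eq_square)
  also have "\<dots> = (sqrt 3 * 2 powr (real ?n / 2))\<^sup>2"
  proof -
    have "(2 powr (real ?n / 2))\<^sup>2 = (2 powr (real ?n / 2 + real ?n / 2) :: real)"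
      by (simp only: power2_eq_square powr_add)
    also have "\<dots> = 2 ^ ?n"
      by (simp add: powr_realpow)
    finally show ?thesis
      by (simp add: power_mult_distrib)
  qed
  finally show "real ?s < sqrt 3 * 2 powr (real ?n / 2)"
    by (rule power_less_imp_less_base) simp
qed

end
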